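(* Let $K$ be a function field over $\mathbb{F}_q$ with a rational place $\infty$, let $A$ be the ring of elements of $K$ regular outside $\infty$, and let $v$ be a monic prime of $A$. Let $n$ be an odd positive integer and let $s_1,\dots,s_n\in\mathbb{Z}$ be pairwise distinct $q$-even integers, $\mathbf{s}=(s_1,\dots,s_n)$. Then $$\sum_{\sigma\in S_n}\operatorname{sgn}(\sigma)\,\zeta_v(\sigma(\mathbf{s}))=0,$$ where $\sigma(\mathbf{s})=(s_{\sigma(1)},\dots,s_{\sigma(n)})$.
   Context: $q$ is a power of a prime $p$. An integer $s$ is called $q$-even if $(q-1)\mid s$. A sign function on $K_\infty$ is fixed, so that "monic" makes sense; $A_{d+}$ denotes the set of monic elements of $A$ of degree $d$ (degree $=-\mathrm{ord}_\infty$, $\infty$ being rational). For a monic prime $v$ of $A$, $K_v$ is the completion of $K$ at $v$, and for $k\in\mathbb{Z}$, $d\ge 0$, $\widetilde{S}_d(k):=\sum_{a\in A_{d+},\,(a,v)=1} a^{-k}\in K$. For $\mathbf{s}=(s_1,\dots,s_r)\in\mathbb{Z}^r$ the $v$-adic multiple zeta value is $\zeta_v(\mathbf{s}):=\sum_{d_1>d_2>\cdots>d_r\ge 0}\widetilde{S}_{d_1}(s_1)\cdots\widetilde{S}_{d_r}(s_r)\in K_v$ (this series converges in $K_v$ for all integer $s_i$). $S_n$ is the symmetric group on $\{1,\dots,n\}$ and $\operatorname{sgn}$ its sign character. *)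

theory Defs
  imports
    "HOL-Analysis.Analysis"
    "HOL-Computational_Algebra.Computational_Algebra"
    "HOL-Combinatorics.Permutations"
begin

section \<open>Function fields and places\<close>

text \<open>The function field \<open>K\<close> is the whole type \<open>'k\<close>; its field of constants is a subset \<open>F\<close>.\<close>

definition is_subfield :: "'k::field set \<Rightarrow> bool" where
  "is_subfield F \<longleftrightarrow> 0 \<in> F \<and> 1 \<in> F \<and>
     (\<forall>x\<in>F. \<forall>y\<in>F. x + y \<in> F \<and> x * y \<in> F) \<and> (\<forall>x\<in>F. - x \<in> F \<and> inverse x \<in> F)"

definition polys_over :: "'k::field set \<Rightarrow> 'k poly set" where
  "polys_over F = {f. \<forall>i. coeff f i \<in> F}"

definition transcendental_over :: "'k::field set \<Rightarrow> 'k \<Rightarrow> bool" where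
  "transcendental_over F t \<longleftrightarrow> (\<forall>f\<in>polys_over F. poly f t = 0 \<longrightarrow> f = 0)"

definition simple_extension :: "'k::field set \<Rightarrow> 'k \<Rightarrow> 'k set" where
  "simple_extension F t = {poly f t / poly g t | f g.
     f \<in> polys_over F \<and> g \<in> polys_over F \<and> poly g t \<noteq> 0}"

definition finite_over :: "'k::field set \<Rightarrow> bool" where
  "finite_over E \<longleftrightarrow>
     (\<exists>B. finite B \<and> (\<forall>x. \<exists>c. (\<forall>b\<in>B. c b \<in> E) \<and> x = (\<Sum>b\<in>B. c b * b)))"

definition function_field :: "'k::field set \<Rightarrow> bool" where
  "function_field F \<longleftrightarrow> is_subfield F \<and>
     (\<exists>t. transcendental_over F t \<and> finite_over (simple_extension F t))"

text \<open>
  A place is given by its normalized discrete valuation \<open>w\<close>. The integer \<open>w 0\<close> has no meaning (the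
  true value is infinity); it is fixed to be \<open>0\<close> so that distinct functions are distinct places.
\<close>

definition place :: "'k::field set \<Rightarrow> ('k \<Rightarrow> int) \<Rightarrow> bool" where
  "place F w \<longleftrightarrow> w 0 = 0 \<and>
     (\<forall>x y. x \<noteq> 0 \<longrightarrow> y \<noteq> 0 \<longrightarrow> w (x * y) = w x + w y) \<and>
     (\<forall>x y. x \<noteq> 0 \<longrightarrow> y \<noteq> 0 \<longrightarrow> x + y \<noteq> 0 \<longrightarrow> min (w x) (w y) \<le> w (x + y)) \<and>
     (\<forall>c\<in>F. c \<noteq> 0 \<longrightarrow> w c = 0) \<and>
     (\<exists>x. x \<noteq> 0 \<and> w x = 1)"

definition valuation_ring :: "('k::field \<Rightarrow> int) \<Rightarrow> 'k set" where
  "valuation_ring w = {x. x = 0 \<or> 0 \<le> w x}"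

definition valuation_ideal :: "('k::field \<Rightarrow> int) \<Rightarrow> 'k set" where
  "valuation_ideal w = {x. x = 0 \<or> 0 < w x}"

definition rational_place :: "'k::field set \<Rightarrow> ('k \<Rightarrow> int) \<Rightarrow> bool" where
  "rational_place F w \<longleftrightarrow> place F w \<and>
     (\<forall>x\<in>valuation_ring w. \<exists>c\<in>F. x - c \<in> valuation_ideal w)"

definition regular_ring :: "'k::field set \<Rightarrow> ('k \<Rightarrow> int) \<Rightarrow> 'k set" where
  "regular_ring F ord_inf = {x. \<forall>w. place F w \<and> w \<noteq> ord_inf \<longrightarrow> x \<in> valuation_ring w}"


section \<open>Completions and sign functions\<close>

text \<open>
  \<open>\<iota>\<close> exhibits the type \<open>'l\<close> as the completion of \<open>K\<close> at \<open>w\<close>: the metric of \<open>'l\<close>, which is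
  complete by the type class, comes from an absolute value extending \<open>c powr - w x\<close> for some
  \<open>c > 1\<close>, and the image of \<open>K\<close> is dense. This determines \<open>'l\<close> up to unique isomorphism of
  topological fields over \<open>K\<close>.
\<close>

definition completion_at ::
    "('k::field \<Rightarrow> int) \<Rightarrow> ('k \<Rightarrow> 'l::{field,complete_space}) \<Rightarrow> bool" where
  "completion_at w \<iota> \<longleftrightarrow>
     \<iota> 1 = 1 \<and> (\<forall>x y. \<iota> (x + y) = \<iota> x + \<iota> y) \<and> (\<forall>x y. \<iota> (x * y) = \<iota> x * \<iota> y) \<and>
     (\<forall>x y :: 'l. dist x y = dist (x - y) 0) \<and>
     (\<forall>x y :: 'l. dist (x * y) 0 = dist x 0 * dist y 0) \<and>
     (\<exists>c>1. \<forall>x. x \<noteq> 0 \<longrightarrow> dist (\<iota> x) 0 = c powr (- real_of_int (w x))) \<and>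
     closure (range \<iota>) = UNIV"

text \<open>
  For a rational place the residue field of the completion is \<open>F\<close>, so signs take values in the
  nonzero elements of \<open>F\<close>. The value of \<open>sg\<close> at \<open>0\<close> is irrelevant.
\<close>

definition sign_function ::
    "'k::field set \<Rightarrow> ('k \<Rightarrow> 'l::{field,complete_space}) \<Rightarrow> ('l \<Rightarrow> 'k) \<Rightarrow> bool" where
  "sign_function F \<iota> sg \<longleftrightarrow>
     (\<forall>x. x \<noteq> 0 \<longrightarrow> sg x \<in> F - {0}) \<and>
     (\<forall>x y. x \<noteq> 0 \<longrightarrow> y \<noteq> 0 \<longrightarrow> sg (x * y) = sg x * sg y) \<and>
     (\<forall>c\<in>F - {0}. sg (\<iota> c) = c) \<and>
     (\<forall>u. dist u 1 < 1 \<longrightarrow> sg u = 1)"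


section \<open>Primes of the coordinate ring\<close>

definition principal_ideal_of :: "'k::field set \<Rightarrow> 'k \<Rightarrow> 'k set" where
  "principal_ideal_of A v = {v * b | b. b \<in> A}"

definition prime_element_of :: "'k::field set \<Rightarrow> 'k \<Rightarrow> bool" where
  "prime_element_of A v \<longleftrightarrow> v \<in> A \<and> v \<noteq> 0 \<and> 1 \<notin> principal_ideal_of A v \<and>
     (\<forall>a\<in>A. \<forall>b\<in>A. a * b \<in> principal_ideal_of A v \<longrightarrow>
        a \<in> principal_ideal_of A v \<or> b \<in> principal_ideal_of A v)"

definition coprime_in :: "'k::field set \<Rightarrow> 'k \<Rightarrow> 'k \<Rightarrow> bool" where
  "coprime_in A a b \<longleftrightarrow> (\<exists>x\<in>A. \<exists>y\<in>A. x * a + y * b = 1)"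

definition place_of_prime :: "'k::field set \<Rightarrow> ('k \<Rightarrow> int) \<Rightarrow> 'k \<Rightarrow> ('k \<Rightarrow> int) \<Rightarrow> bool" where
  "place_of_prime F ord_inf v w \<longleftrightarrow> place F w \<and> w \<noteq> ord_inf \<and>
     regular_ring F ord_inf \<inter> valuation_ideal w = principal_ideal_of (regular_ring F ord_inf) v"


section \<open>Power sums and \<open>v\<close>-adic multiple zeta values\<close>

text \<open>In this section \<open>sg\<close> is the restriction to \<open>K\<close> of a sign function.\<close>

definition monics ::
    "'k::field set \<Rightarrow> ('k \<Rightarrow> int) \<Rightarrow> ('k \<Rightarrow> 'k) \<Rightarrow> nat \<Rightarrow> 'k set" where
  "monics F ord_inf sg d = {a \<in> regular_ring F ord_inf. a \<noteq> 0 \<and> - ord_inf a = int d \<and> sg a = 1}"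

definition power_sum ::
    "'k::field set \<Rightarrow> ('k \<Rightarrow> int) \<Rightarrow> ('k \<Rightarrow> 'k) \<Rightarrow> 'k \<Rightarrow> nat \<Rightarrow> int \<Rightarrow> 'k" where
  "power_sum F ord_inf sg v d k =
     (\<Sum>a | a \<in> monics F ord_inf sg d \<and> coprime_in (regular_ring F ord_inf) a v. a powi (- k))"

text \<open>
  The sum over \<open>d\<^sub>1 > \<dots> > d\<^sub>r \<ge> 0\<close> is taken unconditionally over the strictly decreasing lists
  of length \<open>r\<close>; \<open>\<iota>\<close> is the embedding of \<open>K\<close> in its completion at the place of \<open>v\<close>.
\<close>

definition zeta_v ::
    "'k::field set \<Rightarrow> ('k \<Rightarrow> int) \<Rightarrow> ('k \<Rightarrow> 'k) \<Rightarrow> 'k \<Rightarrow> ('k \<Rightarrow> 'l::{field,complete_space})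
      \<Rightarrow> int list \<Rightarrow> 'l" where
  "zeta_v F ord_inf sg v \<iota> s =
     (\<Sum>\<^sub>\<infinity>d\<in>{d. length d = length s \<and> sorted_wrt (>) d}.
        \<Prod>i<length s. \<iota> (power_sum F ord_inf sg v (d ! i) (s ! i)))"

definition q_even :: "nat \<Rightarrow> int \<Rightarrow> bool" where
  "q_even q s \<longleftrightarrow> int q - 1 dvd s"

end

theory Submission
  imports Defs
begin

text \<open>
  Write \<open>x\<^sub>d\<close> for the vector of the power sums of degree \<open>d\<close> at \<open>s\<^sub>1, \<dots>, s\<^sub>n\<close>. The alternating
  sum of the zeta values is the sum of \<open>det (x\<^bsub>d_1\<^esub>, \<dots>, x\<^bsub>d_n\<^esub>)\<close> over \<open>d\<^sub>1 > \<dots> > d\<^sub>n\<close>. In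
  \<open>(\<Sum>d. x\<^sub>d) \<and> (\<Sum>d\<^sub>2 > \<dots> > d\<^sub>n. x\<^bsub>d_2\<^esub> \<and> \<dots> \<and> x\<^bsub>d_n\<^esub>)\<close> each decreasing wedge product occurs with
  the signs \<open>1, -1, \<dots>, 1\<close>, which add up to \<open>1\<close> for odd \<open>n\<close>, so the determinant sum equals this
  product. The first factor vanishes because \<open>\<Sum>d. x\<^sub>d\<close> is the vector of the single zeta values:
  for \<open>q\<close>-even \<open>k\<close> the sum of \<open>a powi (- k)\<close> over the monic \<open>a\<close> of degree below \<open>D\<close> prime to \<open>v\<close>
  is minus the sum over all such \<open>a\<close>, and for large \<open>D\<close> the latter is divisible by \<open>v ^ m\<close>, by
  translation invariance under \<open>v ^ m\<close>.
\<close>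

section \<open>Alternating sums over decreasing lists\<close>

text \<open>Vanishing on repeated entries is demanded separately, because in characteristic 2 it
  does not follow from the sign change. Adjacent entries are enough for the induction below.\<close>

definition alternating_lists :: "nat \<Rightarrow> (nat list \<Rightarrow> 'a::ring_1) \<Rightarrow> bool" where
  "alternating_lists n f \<longleftrightarrow> (\<forall>xs a b ys. length xs + length ys + 2 = n \<longrightarrow>
     f (xs @ a # b # ys) = - f (xs @ b # a # ys) \<and> f (xs @ a # a # ys) = 0)"

text \<open>These finite sets exhaust the index set of \<open>zeta_v\<close> as the cutoff
  \<open>D\<close> grows.\<close>

definition decreasing_below :: "nat \<Rightarrow> nat \<Rightarrow> nat list set" where
  "decreasing_below m D = {d. length d = m \<and> sorted_wrt (>) d \<and> set d \<subseteq> {..<D}}"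

lemma decreasing_below_0 [simp]: "decreasing_below 0 D = {[]}"
  by (auto simp: decreasing_below_def)

lemma decreasing_below_Suc_0 [simp]: "decreasing_below (Suc m) 0 = {}"
  by (auto simp: decreasing_below_def)

lemma finite_decreasing_below [simp]: "finite (decreasing_below m D)"
proof (rule finite_subset)
  show "decreasing_below m D \<subseteq> {xs. set xs \<subseteq> {..<D} \<and> length xs = m}"
    by (auto simp: decreasing_below_def)
qed (simp add: finite_lists_length_eq)

text \<open>In a strictly decreasing list with entries at most \<open>D\<close>, only the head can
  equal \<open>D\<close>.\<close>

lemma decreasing_below_Suc_Suc:
  "decreasing_below (Suc m) (Suc D) =
     decreasing_below (Suc m) D \<union> (#) D ` decreasing_below m D"
proof (intro equalityI subsetI)
  fix d assume "d \<in> decreasing_below (Suc m) (Suc D)"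
  then obtain a ds where d: "d = a # ds" "length ds = m" "sorted_wrt (>) ds"
    "\<forall>b\<in>set ds. b < a" "a < Suc D"
    by (auto simp: decreasing_below_def length_Suc_conv)
  show "d \<in> decreasing_below (Suc m) D \<union> (#) D ` decreasing_below m D"
  proof (cases "a = D")
    case True
    then show ?thesis using d by (auto simp: decreasing_below_def)
  next
    case False
    then have "a < D" using d by simp
    then show ?thesis using d by (force simp: decreasing_below_def)
  qed
qed (force simp: decreasing_below_def)

lemma sum_decreasing_below_Suc_Suc:
  fixes f :: "nat list \<Rightarrow> 'a::comm_monoid_add"
  shows "sum f (decreasing_below (Suc m) (Suc D)) =
    sum f (decreasing_below (Suc m) D) + (\<Sum>d\<in>decreasing_below m D. f (D # d))"
proof -
  have "decreasing_below (Suc m) D \<inter> (#) D ` decreasing_below m D = {}"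
    by (auto simp: decreasing_below_def)
  moreover have "inj_on ((#) D) (decreasing_below m D)"
    by (auto simp: inj_on_def)
  ultimately show ?thesis
    by (simp add: decreasing_below_Suc_Suc sum.union_disjoint sum.reindex)
qed

lemma alternating_lists_Cons:
  assumes "alternating_lists (Suc n) f"
  shows "alternating_lists n (\<lambda>d. f (a # d))"
  unfolding alternating_lists_def
proof (intro allI impI)
  fix xs ys :: "nat list" and b c :: nat assume "length xs + length ys + 2 = n"
  then show "f (a # xs @ b # c # ys) = - f (a # xs @ c # b # ys) \<and> f (a # xs @ b # b # ys) = 0"
    using assms[unfolded alternating_lists_def, rule_format, of "a # xs" ys b c] by simp
qed

text \<open>
  In the exterior algebra this says that the sum \<open>W\<^sub>m\<close> of the wedge products over decreasing
  index lists of length \<open>m\<close> satisfies \<open>W\<^sub>1 \<and> W\<^sub>m = W\<^bsub>m+1\<^esub>\<close> for \<open>m\<close> even and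
  \<open>W\<^sub>1 \<and> W\<^sub>m = 0\<close> for \<open>m\<close> odd.
\<close>

lemma sum_alternating_lists:
  assumes "alternating_lists (Suc m) f"
  shows "(\<Sum>d0<D. \<Sum>d\<in>decreasing_below m D. f (d0 # d)) =
    (if even m then sum f (decreasing_below (Suc m) D) else 0)"
  using assms
proof (induction D arbitrary: m f)
  case 0
  then show ?case by simp
next
  case (Suc D)
  show ?case
  proof (cases m)
    case 0
    then show ?thesis
      using Suc.IH[OF Suc.prems] by (simp add: sum_decreasing_below_Suc_Suc)
  next
    case (Suc l)
    define g where "g = (\<lambda>d. f (D # d))"
    have alt: "alternating_lists (Suc l) g"
      using alternating_lists_Cons[of "Suc l" f D] Suc.prems Suc by (simp add: g_def)
    \<comment> \<open>Moving \<open>D\<close> past \<open>d0\<close> to the front costs one sign,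
      and a repeated \<open>D\<close> kills the term.\<close>
    have swap: "f (d0 # D # d) = - g (d0 # d)" "f (D # D # d) = 0"
      if "d \<in> decreasing_below l D" for d0 d
      using Suc.prems[unfolded alternating_lists_def, rule_format, of "[]" d d0 D]
        Suc.prems[unfolded alternating_lists_def, rule_format, of "[]" d D D] that Suc
      by (simp_all add: decreasing_below_def g_def)
    \<comment> \<open>Four blocks arise, according to whether \<open>d0\<close> equals
      \<open>D\<close> and whether \<open>d\<close> begins with \<open>D\<close>.\<close>
    have "(\<Sum>d0<Suc D. \<Sum>d\<in>decreasing_below m (Suc D). f (d0 # d)) =
        (\<Sum>d0<D. \<Sum>d\<in>decreasing_below m D. f (d0 # d))
        + (\<Sum>d0<D. \<Sum>d\<in>decreasing_below l D. f (d0 # D # d))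
        + (\<Sum>d\<in>decreasing_below m D. f (D # d)) + (\<Sum>d\<in>decreasing_below l D. f (D # D # d))"
      by (simp add: Suc sum_decreasing_below_Suc_Suc sum.distrib add.assoc)
    also have "(\<Sum>d\<in>decreasing_below l D. f (D # D # d)) = 0"
      by (intro sum.neutral ballI swap)
    also have "(\<Sum>d0<D. \<Sum>d\<in>decreasing_below l D. f (d0 # D # d)) =
        - (\<Sum>d0<D. \<Sum>d\<in>decreasing_below l D. g (d0 # d))"
      by (simp add: swap(1) sum_negf cong: sum.cong)
    also have "(\<Sum>d0<D. \<Sum>d\<in>decreasing_below l D. g (d0 # d)) =
        (if even l then sum g (decreasing_below m D) else 0)"
      using Suc.IH[OF alt] Suc by simp
    also have "(\<Sum>d0<D. \<Sum>d\<in>decreasing_below m D. f (d0 # d)) =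
        (if even m then sum f (decreasing_below (Suc m) D) else 0)"
      by (rule Suc.IH[OF Suc.prems])
    finally have lhs: "(\<Sum>d0<Suc D. \<Sum>d\<in>decreasing_below m (Suc D). f (d0 # d)) =
        (if even m then sum f (decreasing_below (Suc m) D) else 0)
        + - (if even l then sum g (decreasing_below m D) else 0) + sum g (decreasing_below m D) + 0"
      by (simp only: g_def)
    \<comment> \<open>For even \<open>m\<close> the block with \<open>d0 = D\<close> supplies
      exactly the lists headed by \<open>D\<close>. For odd \<open>m\<close> it cancels against the
      block in which \<open>d\<close> begins with \<open>D\<close>.\<close>
    show ?thesis
      unfolding lhs sum_decreasing_below_Suc_Suc using Suc by (simp add: g_def)
  qed
qed

section \<open>Leibniz determinants with rows selected by an index list\<close>

definition list_det :: "(nat \<Rightarrow> nat \<Rightarrow> 'a::comm_ring_1) \<Rightarrow> nat \<Rightarrow> nat list \<Rightarrow> 'a" where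
  "list_det y n d = (\<Sum>\<sigma> | \<sigma> permutes {..<n}. of_int (sign \<sigma>) * (\<Prod>i<n. y (d ! i) (\<sigma> i)))"

text \<open>Composing the permutations with an adjacent transposition reindexes the Leibniz sum,
  flips all signs and exchanges two neighbouring rows.\<close>

lemma alternating_list_det: "alternating_lists n (list_det y n)"
  unfolding alternating_lists_def
proof (intro allI impI)
  fix xs ys :: "nat list" and a b :: nat
  assume n: "length xs + length ys + 2 = n"
  define \<tau> where "\<tau> = Transposition.transpose (length xs) (Suc (length xs))"
  have \<tau>: "\<tau> permutes {..<n}"
    unfolding \<tau>_def using n by (intro permutes_swap_id) auto
  define t where "t = (\<lambda>d \<sigma>. of_int (sign \<sigma>) * (\<Prod>i<n. y (d ! i) (\<sigma> i)))"
  have nth: "(xs @ b # a # ys) ! \<tau> i = (xs @ a # b # ys) ! i" for a b i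
    by (cases "i < length xs"; cases "i = length xs"; cases "i = Suc (length xs)")
      (auto simp: \<tau>_def Transposition.transpose_def nth_append nth_Cons')
  have t: "t (xs @ b # a # ys) (\<sigma> \<circ> \<tau>) = - t (xs @ a # b # ys) \<sigma>"
    if "\<sigma> permutes {..<n}" for \<sigma> a b
  proof -
    have "sign (\<sigma> \<circ> \<tau>) = sign \<sigma> * sign \<tau>"
      using that \<tau> by (intro sign_compose permutes_imp_permutation[of "{..<n}"]) auto
    then have sgn: "sign (\<sigma> \<circ> \<tau>) = - sign \<sigma>"
      by (simp add: \<tau>_def sign_swap_id)
    have "(\<Prod>i<n. y ((xs @ a # b # ys) ! i) (\<sigma> i)) =
        (\<Prod>i<n. y ((xs @ a # b # ys) ! \<tau> i) (\<sigma> (\<tau> i)))"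
      using prod.permute[OF \<tau>, of "\<lambda>i. y ((xs @ a # b # ys) ! i) (\<sigma> i)"] by (simp add: o_def)
    also have "\<dots> = (\<Prod>i<n. y ((xs @ b # a # ys) ! i) (\<sigma> (\<tau> i)))"
      by (simp add: nth)
    finally show ?thesis by (simp add: t_def sgn)
  qed
  have det: "list_det y n d = (\<Sum>\<sigma> | \<sigma> permutes {..<n}. t d \<sigma>)" for d
    by (simp add: list_det_def t_def)
  have "list_det y n (xs @ a # b # ys) = (\<Sum>\<sigma> | \<sigma> permutes {..<n}. t (xs @ a # b # ys) (\<sigma> \<circ> \<tau>))"
    unfolding det by (rule sum_permutations_compose_right[OF \<tau>])
  also have "\<dots> = - list_det y n (xs @ b # a # ys)"
    by (simp add: det t sum_negf)
  finally have 1: "list_det y n (xs @ a # b # ys) = - list_det y n (xs @ b # a # ys)" .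
  \<comment> \<open>Since 2 may be zero in the ring, two equal rows are handled by pairing each even
    permutation with the odd one obtained from the transposition.\<close>
  define E where "E = {\<sigma>. \<sigma> permutes {..<n} \<and> evenperm \<sigma>}"
  define O' where "O' = {\<sigma>. \<sigma> permutes {..<n} \<and> \<not> evenperm \<sigma>}"
  have fin: "finite E" "finite O'"
    using finite_permutations[of "{..<n}"] by (auto simp: E_def O'_def)
  have ev: "evenperm (\<sigma> \<circ> \<tau>) \<longleftrightarrow> \<not> evenperm \<sigma>" if "\<sigma> permutes {..<n}" for \<sigma>
  proof -
    have "evenperm (\<sigma> \<circ> \<tau>) = (evenperm \<sigma> = evenperm \<tau>)"
      using that \<tau> by (intro evenperm_comp permutes_imp_permutation[of "{..<n}"]) auto
    then show ?thesis by (simp add: \<tau>_def evenperm_swap)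
  qed
  have \<tau>\<tau>: "\<sigma> \<circ> \<tau> \<circ> \<tau> = \<sigma>" for \<sigma> :: "nat \<Rightarrow> nat"
    by (auto simp: \<tau>_def fun_eq_iff)
  have bij: "bij_betw (\<lambda>\<sigma>. \<sigma> \<circ> \<tau>) E O'"
    by (rule bij_betw_byWitness[where f' = "\<lambda>\<sigma>. \<sigma> \<circ> \<tau>"])
      (use \<tau>\<tau> ev permutes_compose[OF \<tau>] in \<open>auto simp: E_def O'_def\<close>)
  have "list_det y n (xs @ a # a # ys) = sum (t (xs @ a # a # ys)) (E \<union> O')"
    unfolding det by (rule sum.cong) (auto simp: E_def O'_def)
  also have "\<dots> = sum (t (xs @ a # a # ys)) E + sum (t (xs @ a # a # ys)) O'"
    using fin by (intro sum.union_disjoint) (auto simp: E_def O'_def)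
  also have "sum (t (xs @ a # a # ys)) O' = (\<Sum>\<sigma>\<in>E. t (xs @ a # a # ys) (\<sigma> \<circ> \<tau>))"
    by (rule sum.reindex_bij_betw[OF bij, symmetric])
  also have "\<dots> = - sum (t (xs @ a # a # ys)) E"
    by (simp add: t E_def sum_negf)
  finally show "list_det y n (xs @ a # b # ys) = - list_det y n (xs @ b # a # ys) \<and>
      list_det y n (xs @ a # a # ys) = 0"
    using 1 by simp
qed

section \<open>Series in complete ultrametric fields\<close>

text \<open>\<open>N\<close> is the absolute value behind the metric; it is later instantiated with
  the distance to 0.\<close>

locale ultrametric_field =
  fixes N :: "'l::{field,complete_space} \<Rightarrow> real"
  assumes dist_eq: "dist x y = N (x - y)"
    and N_mult: "N (x * y) = N x * N y"
    and N_add: "N (x + y) \<le> max (N x) (N y)"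
begin

lemma N_0 [simp]: "N 0 = 0"
  using dist_eq[of 0 0] by simp

lemma N_nonneg [simp]: "0 \<le> N x"
  using dist_eq[of x 0] zero_le_dist[of x 0] by simp

lemma N_eq_0 [simp]: "N x = 0 \<longleftrightarrow> x = 0"
  using dist_eq[of x 0] by (metis diff_zero dist_eq_0_iff)

lemma N_1 [simp]: "N 1 = 1"
  using N_mult[of 1 1] N_eq_0[of 1] by simp

lemma N_minus [simp]: "N (- x) = N x"
  using dist_eq[of x 0] dist_eq[of 0 x] by (simp add: dist_commute)

lemma N_diff: "N (x - y) \<le> max (N x) (N y)"
  using N_add[of x "- y"] by simp

lemma N_inverse: "N (inverse x) = inverse (N x)"
proof (cases "x = 0")
  case False
  then have "N x * N (inverse x) = 1" using N_mult[of x "inverse x"] by simp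
  then show ?thesis by (metis inverse_unique)
qed simp

lemma N_power: "N (x ^ m) = N x ^ m"
  by (induction m) (simp_all add: N_mult)

lemma N_powi: "N (x powi k) = N x powi k"
  by (simp add: power_int_def N_power N_inverse)

lemma N_prod: "N (prod f A) = (\<Prod>a\<in>A. N (f a))"
  by (induction A rule: infinite_finite_induct) (simp_all add: N_mult)

lemma N_prod_le_1:
  assumes "\<And>a. a \<in> A \<Longrightarrow> N (f a) \<le> 1"
  shows "N (prod f A) \<le> 1"
  unfolding N_prod using assms by (intro prod_le_1) auto

lemma N_sum_le:
  assumes "\<And>a. a \<in> A \<Longrightarrow> N (f a) \<le> e" and "0 \<le> e"
  shows "N (sum f A) \<le> e"
  using assms
proof (induction A rule: infinite_finite_induct)
  case (insert a A)
  have "N (f a + sum f A) \<le> max (N (f a)) (N (sum f A))" by (rule N_add)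
  also have "\<dots> \<le> e" using insert by simp
  finally show ?case using insert by simp
qed auto

lemma N_of_sign_mult: "N (of_int (sign \<sigma>) * x) = N x"
  by (cases \<sigma> rule: sign_cases) auto

lemma N_power_diff_le:
  assumes "N a \<le> 1" "N b \<le> 1"
  shows "N (a ^ m - b ^ m) \<le> N (a - b)"
proof (induction m)
  case (Suc m)
  have eq: "a ^ Suc m - b ^ Suc m = a * (a ^ m - b ^ m) + (a - b) * b ^ m"
    by (simp add: algebra_simps)
  have "N (a * (a ^ m - b ^ m)) \<le> 1 * N (a - b)"
    unfolding N_mult using assms Suc by (intro mult_mono) auto
  moreover have "N ((a - b) * b ^ m) \<le> N (a - b) * 1"
    unfolding N_mult N_power using assms by (intro mult_mono power_le_one) auto
  ultimately show ?case
    using N_add[of "a * (a ^ m - b ^ m)" "(a - b) * b ^ m"] unfolding eq by simp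
qed simp

text \<open>\<open>a - b\<close> divides \<open>a ^ m - b ^ m\<close>. Negative exponents reduce to
  positive ones because inverting elements of absolute value 1 preserves the size of their
  difference.\<close>

lemma N_powi_diff_le:
  assumes "N a = 1" "N b = 1"
  shows "N (a powi k - b powi k) \<le> N (a - b)"
proof (cases "0 \<le> k")
  case True
  then show ?thesis using N_power_diff_le[of a b "nat k"] assms by (simp add: power_int_def)
next
  case False
  have nz: "a \<noteq> 0" "b \<noteq> 0" using assms by auto
  have "N (inverse a - inverse b) = N ((b - a) * (inverse a * inverse b))"
    using nz by (simp add: field_simps)
  also have "\<dots> = N (b - a)" using assms by (simp add: N_mult N_inverse)
  also have "\<dots> = N (a - b)" by (metis N_minus minus_diff_eq)
  finally show ?thesis
    using N_power_diff_le[of "inverse a" "inverse b" "nat (- k)"] assms False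
    by (simp add: power_int_def N_inverse)
qed

section \<open>Unconditional summation along finite exhaustions\<close>

text \<open>A finite sum is no larger than its largest term. Terms that become small outside the
  finite sets \<open>B D\<close> therefore give a Cauchy condition for arbitrary finite subsets, and
  completeness supplies the limit.\<close>

lemma has_sum_exhaustion:
  assumes fin: "\<And>D. finite (B D)" and sub: "\<And>D. B D \<subseteq> A" and mono: "incseq B"
    and small: "\<And>e. 0 < e \<Longrightarrow> \<exists>D. \<forall>a\<in>A - B D. N (f a) < e"
  shows "\<exists>L. (f has_sum L) A \<and> (\<lambda>D. sum f (B D)) \<longlonglongrightarrow> L"
proof -
  have ex: "\<exists>D. \<forall>G. finite G \<longrightarrow> B D \<subseteq> G \<longrightarrow> G \<subseteq> A \<longrightarrow> N (sum f G - sum f (B D)) < e"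
    if "0 < e" for e
  proof -
    obtain D where D: "\<forall>a\<in>A - B D. N (f a) < e / 2"
      using small[OF half_gt_zero[OF \<open>0 < e\<close>]] by blast
    have "N (sum f G - sum f (B D)) < e" if "finite G" "B D \<subseteq> G" "G \<subseteq> A" for G
    proof -
      have "sum f G - sum f (B D) = sum f (G - B D)"
        using that by (simp add: sum_diff)
      also have "N \<dots> \<le> e / 2"
        using D that \<open>0 < e\<close> by (intro N_sum_le) (auto intro: less_imp_le)
      finally show ?thesis using \<open>0 < e\<close> by simp
    qed
    then show ?thesis by blast
  qed
  have "Cauchy (\<lambda>D. sum f (B D))"
  proof (rule metric_CauchyI)
    fix e :: real assume "0 < e"
    then obtain D where D: "\<And>G. \<lbrakk>finite G; B D \<subseteq> G; G \<subseteq> A\<rbrakk> \<Longrightarrow> N (sum f G - sum f (B D)) < e / 2"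
      using ex[of "e / 2"] by auto
    have "dist (sum f (B m)) (sum f (B k)) < e" if "D \<le> m" "D \<le> k" for m k
    proof -
      have "dist (sum f (B j)) (sum f (B D)) < e / 2" if "D \<le> j" for j
        unfolding dist_eq using mono that by (intro D fin sub) (auto simp: incseq_def)
      with that show ?thesis by (blast intro: dist_triangle_half_r dist_triangle_half_l)
    qed
    then show "\<exists>M. \<forall>m\<ge>M. \<forall>k\<ge>M. dist (sum f (B m)) (sum f (B k)) < e" by blast
  qed
  then obtain L where L: "(\<lambda>D. sum f (B D)) \<longlonglongrightarrow> L"
    using Cauchy_convergent convergent_def by blast
  have "(f has_sum L) A"
    unfolding has_sum_def tendsto_iff
  proof (intro allI impI)
    fix e :: real assume "0 < e"
    then obtain D where D: "\<And>G. \<lbrakk>finite G; B D \<subseteq> G; G \<subseteq> A\<rbrakk> \<Longrightarrow> N (sum f G - sum f (B D)) < e / 4"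
      using ex[of "e / 4"] by auto
    have lim: "eventually (\<lambda>m. dist (sum f (B m)) L < e / 4) sequentially"
      using tendstoD[OF L, of "e / 4"] \<open>0 < e\<close> by simp
    \<comment> \<open>\<open>D\<close> controls all finite sums over supersets of
      \<open>B D\<close>; the later index \<open>m\<close> links them to the limit
      \<open>L\<close>.\<close>
    obtain m where m: "D \<le> m" "dist (sum f (B m)) L < e / 4"
      using eventually_conj[OF lim eventually_ge_at_top[of D]]
      by (auto dest: eventually_happens)
    have "dist (sum f G) L < e" if "finite G" "G \<subseteq> A" "B D \<subseteq> G" for G
    proof -
      have "dist (sum f G) (sum f (B D)) < e / 4"
        unfolding dist_eq using that by (intro D)
      moreover have "dist (sum f (B m)) (sum f (B D)) < e / 4"
        unfolding dist_eq using mono m by (intro D fin sub) (auto simp: incseq_def)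
      moreover have "dist (sum f G) L \<le> dist (sum f G) (sum f (B D)) + dist (sum f (B D)) L"
        by (rule dist_triangle)
      moreover have "dist (sum f (B D)) L \<le> dist (sum f (B m)) (sum f (B D)) + dist (sum f (B m)) L"
        by (rule dist_triangle3)
      ultimately show ?thesis using m \<open>0 < e\<close> by linarith
    qed
    then show "eventually (\<lambda>G. dist (sum f G) L < e) (finite_subsets_at_top A)"
      unfolding eventually_finite_subsets_at_top using fin[of D] sub[of D] by blast
  qed
  with L show ?thesis by blast
qed

text \<open>A list outside \<open>decreasing_below n D\<close> has an entry at least
  \<open>D\<close>. One small factor makes the whole product small, since the other factors have
  size at most 1.\<close>

lemma sum_over_decreasing_tendsto:
  assumes le1: "\<And>d i. i < n \<Longrightarrow> N (y d i) \<le> 1"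
    and small: "\<And>e. 0 < e \<Longrightarrow> \<exists>D. \<forall>d\<ge>D. \<forall>i<n. N (y d i) < e"
  shows "(\<lambda>D. \<Sum>d\<in>decreasing_below n D. \<Prod>i<n. y (d ! i) i)
    \<longlonglongrightarrow> (\<Sum>\<^sub>\<infinity>d\<in>{d. length d = n \<and> sorted_wrt (>) d}. \<Prod>i<n. y (d ! i) i)"
proof -
  define A where "A = {d :: nat list. length d = n \<and> sorted_wrt (>) d}"
  define f where "f = (\<lambda>d. \<Prod>i<n. y (d ! i) i)"
  have "\<exists>L. (f has_sum L) A \<and> (\<lambda>D. sum f (decreasing_below n D)) \<longlonglongrightarrow> L"
  proof (rule has_sum_exhaustion)
    show "decreasing_below n D \<subseteq> A" for D by (auto simp: decreasing_below_def A_def)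
    show "incseq (decreasing_below n)" by (force simp: decreasing_below_def incseq_def)
    fix e :: real assume "0 < e"
    then obtain D where D: "\<And>d i. D \<le> d \<Longrightarrow> i < n \<Longrightarrow> N (y d i) < e"
      using small by blast
    have "N (f d) < e" if "d \<in> A - decreasing_below n D" for d
    proof -
      have "length d = n" "\<not> set d \<subseteq> {..<D}"
        using that by (auto simp: A_def decreasing_below_def)
      then obtain j where j: "j < n" "D \<le> d ! j"
        by (metis in_set_conv_nth lessThan_iff not_le subsetI)
      have "f d = y (d ! j) j * (\<Prod>i\<in>{..<n} - {j}. y (d ! i) i)"
        using j by (simp add: f_def prod.remove)
      then have "N (f d) = N (y (d ! j) j) * N (\<Prod>i\<in>{..<n} - {j}. y (d ! i) i)"
        by (simp add: N_mult)
      also have "\<dots> \<le> N (y (d ! j) j) * 1"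
        by (intro mult_left_mono N_prod_le_1 le1) auto
      also have "\<dots> < e" using D j by simp
      finally show ?thesis .
    qed
    then show "\<exists>D. \<forall>a\<in>A - decreasing_below n D. N (f a) < e" by blast
  qed auto
  then obtain L where "(f has_sum L) A" "(\<lambda>D. sum f (decreasing_below n D)) \<longlonglongrightarrow> L" by blast
  moreover from this have "infsum f A = L" by (simp add: infsumI)
  ultimately show ?thesis by (simp add: A_def f_def)
qed

text \<open>As \<open>n - 1\<close> is even, \<open>sum_alternating_lists\<close> frees the first
  index from the ordering. Each Leibniz term then contains a full partial sum of one coordinate as a
  factor, and the remaining factor has size at most 1.\<close>

lemma list_det_sum_small:
  assumes "odd n" and le1: "\<And>d j. j < n \<Longrightarrow> N (y d j) \<le> 1"
    and small: "\<And>j. j < n \<Longrightarrow> N (\<Sum>d<D. y d j) \<le> e"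
  shows "N (sum (list_det y n) (decreasing_below n D)) \<le> e"
proof -
  obtain m where n: "n = Suc m" and "even m"
    using \<open>odd n\<close> by (cases n) auto
  have "0 \<le> e" using small[of 0] n N_nonneg order_trans by blast
  have "sum (list_det y n) (decreasing_below n D) =
      (\<Sum>d0<D. \<Sum>d\<in>decreasing_below m D. list_det y n (d0 # d))"
    using sum_alternating_lists[of m "list_det y n" D] alternating_list_det[of n y] \<open>even m\<close>
    by (simp add: n)
  also have "\<dots> = (\<Sum>d0<D. \<Sum>d\<in>decreasing_below m D. \<Sum>\<sigma> | \<sigma> permutes {..<n}.
      of_int (sign \<sigma>) * (y d0 (\<sigma> 0) * (\<Prod>i<m. y (d ! i) (\<sigma> (Suc i)))))"
    unfolding list_det_def n prod.lessThan_Suc_shift by simp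
  also have "\<dots> = (\<Sum>d0<D. \<Sum>\<sigma> | \<sigma> permutes {..<n}. \<Sum>d\<in>decreasing_below m D.
      of_int (sign \<sigma>) * (y d0 (\<sigma> 0) * (\<Prod>i<m. y (d ! i) (\<sigma> (Suc i)))))"
    by (intro sum.cong sum.swap refl)
  also have "\<dots> = (\<Sum>\<sigma> | \<sigma> permutes {..<n}. \<Sum>d0<D. \<Sum>d\<in>decreasing_below m D.
      of_int (sign \<sigma>) * (y d0 (\<sigma> 0) * (\<Prod>i<m. y (d ! i) (\<sigma> (Suc i)))))"
    by (rule sum.swap)
  also have "\<dots> = (\<Sum>\<sigma> | \<sigma> permutes {..<n}. of_int (sign \<sigma>) *
      ((\<Sum>d0<D. y d0 (\<sigma> 0)) * (\<Sum>d\<in>decreasing_below m D. \<Prod>i<m. y (d ! i) (\<sigma> (Suc i)))))"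
    unfolding sum_product by (simp only: sum_distrib_left)
  also have "N \<dots> \<le> e"
  proof (rule N_sum_le[OF _ \<open>0 \<le> e\<close>])
    fix \<sigma> assume "\<sigma> \<in> {\<sigma>. \<sigma> permutes {..<n}}"
    then have \<sigma>: "\<sigma> i < n" if "i < n" for i
      using permutes_in_image[of \<sigma> "{..<n}" i] that by simp
    have "N ((\<Sum>d0<D. y d0 (\<sigma> 0)) * (\<Sum>d\<in>decreasing_below m D. \<Prod>i<m. y (d ! i) (\<sigma> (Suc i))))
        \<le> e * 1"
      unfolding N_mult using \<open>0 \<le> e\<close> n
      by (intro mult_mono small N_sum_le N_prod_le_1 le1 \<sigma>) auto
    then show "N (of_int (sign \<sigma>) * ((\<Sum>d0<D. y d0 (\<sigma> 0)) *
        (\<Sum>d\<in>decreasing_below m D. \<Prod>i<m. y (d ! i) (\<sigma> (Suc i))))) \<le> e"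
      by (simp add: N_of_sign_mult)
  qed
  finally show ?thesis .
qed

text \<open>All series are truncated at one cutoff \<open>D\<close>. The signed sum of the
  truncations is a sum of determinants, small by \<open>list_det_sum_small\<close>, and the
  truncation errors are small by convergence.\<close>

theorem alternating_sum_zero:
  fixes x :: "nat \<Rightarrow> 'b \<Rightarrow> 'l"
  assumes "odd n" and len: "length s = n"
    and le1: "\<And>d k. k \<in> set s \<Longrightarrow> N (x d k) \<le> 1"
    and lim: "\<And>k. k \<in> set s \<Longrightarrow> (\<lambda>D. N (\<Sum>d<D. x d k)) \<longlonglongrightarrow> 0"
  shows "(\<Sum>\<sigma> | \<sigma> permutes {..<n}. of_int (sign \<sigma>) *
    (\<Sum>\<^sub>\<infinity>d\<in>{d. length d = n \<and> sorted_wrt (>) d}. \<Prod>i<n. x (d ! i) (permute_list \<sigma> s ! i))) = 0"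
proof -
  \<comment> \<open>Indexing coordinates by positions in \<open>s\<close> lets permutations act on
    column indices.\<close>
  define y where "y = (\<lambda>d j. x d (s ! j))"
  define P where "P = {\<sigma>. \<sigma> permutes {..<n}}"
  define T where "T = (\<lambda>\<sigma> D. \<Sum>d\<in>decreasing_below n D. \<Prod>i<n. y (d ! i) (\<sigma> i))"
  define Z where "Z = (\<lambda>\<sigma>. \<Sum>\<^sub>\<infinity>d\<in>{d. length d = n \<and> sorted_wrt (>) d}. \<Prod>i<n. y (d ! i) (\<sigma> i))"
  have finP: "finite P" by (simp add: P_def finite_permutations)
  have y1: "N (y d j) \<le> 1" if "j < n" for d j
    using that len by (simp add: y_def le1)
  have part: "\<exists>D0. \<forall>D\<ge>D0. \<forall>j<n. N (\<Sum>d<D. y d j) < e" if "0 < e" for e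
  proof -
    have "eventually (\<lambda>D. N (\<Sum>d<D. y d j) < e) sequentially" if "j < n" for j
      unfolding y_def using that len by (intro order_tendstoD(2)[OF lim \<open>0 < e\<close>]) simp
    then have "eventually (\<lambda>D. \<forall>j\<in>{..<n}. N (\<Sum>d<D. y d j) < e) sequentially"
      by (intro eventually_ball_finite) auto
    then show ?thesis by (auto simp: eventually_sequentially)
  qed
  have tend: "T \<sigma> \<longlonglongrightarrow> Z \<sigma>" if "\<sigma> \<in> P" for \<sigma>
    unfolding T_def Z_def
  proof (rule sum_over_decreasing_tendsto)
    have \<sigma>: "\<sigma> i < n" if "i < n" for i
      using permutes_in_image[of \<sigma> "{..<n}" i] that \<open>\<sigma> \<in> P\<close> by (simp add: P_def)
    then show "N (y d (\<sigma> i)) \<le> 1" if "i < n" for d i using that y1 by blast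
    fix e :: real assume "0 < e"
    from part[OF this] obtain D0 where D0: "\<And>D j. D0 \<le> D \<Longrightarrow> j < n \<Longrightarrow> N (\<Sum>d<D. y d j) < e"
      by blast
    have "N (y d (\<sigma> i)) < e" if "D0 \<le> d" "i < n" for d i
    proof -
      \<comment> \<open>Terms are differences of consecutive partial sums, so they tend to zero
        too.\<close>
      have "y d (\<sigma> i) = (\<Sum>d<Suc d. y d (\<sigma> i)) - (\<Sum>d<d. y d (\<sigma> i))" by simp
      then have "N (y d (\<sigma> i)) \<le> max (N (\<Sum>d<Suc d. y d (\<sigma> i))) (N (\<Sum>d<d. y d (\<sigma> i)))"
        by (metis N_diff)
      also have "\<dots> < e" using D0[of "Suc d" "\<sigma> i"] D0[of d "\<sigma> i"] \<sigma>[OF that(2)] that by simp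
      finally show ?thesis .
    qed
    then show "\<exists>D. \<forall>d\<ge>D. \<forall>i<n. N (y d (\<sigma> i)) < e" by blast
  qed
  have "N (\<Sum>\<sigma>\<in>P. of_int (sign \<sigma>) * Z \<sigma>) \<le> e" if "0 < e" for e
  proof -
    obtain D0 where D0: "\<And>D j. D0 \<le> D \<Longrightarrow> j < n \<Longrightarrow> N (\<Sum>d<D. y d j) < e"
      using part[OF \<open>0 < e\<close>] by blast
    have "eventually (\<lambda>D. \<forall>\<sigma>\<in>P. dist (T \<sigma> D) (Z \<sigma>) < e) sequentially"
      using tend \<open>0 < e\<close> finP by (intro eventually_ball_finite) (auto intro: tendstoD)
    then obtain D where D: "D0 \<le> D" "\<And>\<sigma>. \<sigma> \<in> P \<Longrightarrow> dist (T \<sigma> D) (Z \<sigma>) < e"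
      unfolding eventually_sequentially by (meson nle_le)
    have "(\<Sum>\<sigma>\<in>P. of_int (sign \<sigma>) * T \<sigma> D) = sum (list_det y n) (decreasing_below n D)"
      unfolding T_def list_det_def P_def[symmetric] sum_distrib_left by (rule sum.swap)
    then have "N (\<Sum>\<sigma>\<in>P. of_int (sign \<sigma>) * T \<sigma> D) \<le> e"
      using list_det_sum_small[of n y D e] \<open>odd n\<close> y1 D0[OF D(1)] by (simp add: less_imp_le)
    moreover have "N (\<Sum>\<sigma>\<in>P. of_int (sign \<sigma>) * (T \<sigma> D - Z \<sigma>)) \<le> e"
      using D(2) \<open>0 < e\<close> by (intro N_sum_le) (auto simp: N_of_sign_mult dist_eq less_imp_le)
    moreover have "(\<Sum>\<sigma>\<in>P. of_int (sign \<sigma>) * Z \<sigma>) =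
        (\<Sum>\<sigma>\<in>P. of_int (sign \<sigma>) * T \<sigma> D) - (\<Sum>\<sigma>\<in>P. of_int (sign \<sigma>) * (T \<sigma> D - Z \<sigma>))"
      by (simp add: algebra_simps sum_subtractf)
    ultimately show ?thesis
      using N_diff[of "\<Sum>\<sigma>\<in>P. of_int (sign \<sigma>) * T \<sigma> D"
          "\<Sum>\<sigma>\<in>P. of_int (sign \<sigma>) * (T \<sigma> D - Z \<sigma>)"] by simp
  qed
  then have "N (\<Sum>\<sigma>\<in>P. of_int (sign \<sigma>) * Z \<sigma>) \<le> 0"
    by (rule field_le_epsilon[where y = 0, simplified])
  then have "(\<Sum>\<sigma>\<in>P. of_int (sign \<sigma>) * Z \<sigma>) = 0"
    using N_nonneg N_eq_0 by (meson antisym)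
  moreover have "(\<Sum>\<^sub>\<infinity>d\<in>{d. length d = n \<and> sorted_wrt (>) d}.
      \<Prod>i<n. x (d ! i) (permute_list \<sigma> s ! i)) = Z \<sigma>" if "\<sigma> \<in> P" for \<sigma>
    unfolding Z_def using that len
    by (intro infsum_cong prod.cong) (auto simp: y_def P_def permute_list_nth)
  ultimately show ?thesis
    unfolding P_def[symmetric] by (simp cong: sum.cong_simp)
qed

end

section \<open>Places and the coordinate ring\<close>

lemma place_mult: "place F w \<Longrightarrow> x \<noteq> 0 \<Longrightarrow> y \<noteq> 0 \<Longrightarrow> w (x * y) = w x + w y"
  by (simp add: place_def)

lemma place_add:
  "place F w \<Longrightarrow> x \<noteq> 0 \<Longrightarrow> y \<noteq> 0 \<Longrightarrow> x + y \<noteq> 0 \<Longrightarrow> min (w x) (w y) \<le> w (x + y)"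
  by (simp add: place_def)

lemma place_1: "place F w \<Longrightarrow> w 1 = 0"
  using place_mult[of F w 1 1] by simp

lemma place_minus:
  assumes "place F w"
  shows "w (- x) = w x"
proof (cases "x = 0")
  case False
  have "w (- 1) = 0"
    using place_mult[OF assms, of "- 1" "- 1"] place_1[OF assms] by simp
  then show ?thesis
    using place_mult[OF assms, of "- 1" x] False by simp
qed simp

lemma place_inverse:
  assumes "place F w" "x \<noteq> 0"
  shows "w (inverse x) = - w x"
  using place_mult[OF assms(1), of x "inverse x"] place_1[OF assms(1)] assms(2) by simp

lemma place_power:
  assumes "place F w" "x \<noteq> 0"
  shows "w (x ^ m) = int m * w x"
  by (induction m) (simp_all add: place_1[OF assms(1)] place_mult[OF assms(1)] assms(2) algebra_simps)

text \<open>If \<open>1 + u\<close> also had positive valuation, then so would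
  \<open>1 = (1 + u) - u\<close>.\<close>

lemma place_1_plus:
  assumes "place F w" "u \<noteq> 0" "0 < w u"
  shows "1 + u \<noteq> 0" "w (1 + u) = 0"
proof -
  show nz: "1 + u \<noteq> 0"
  proof
    assume "1 + u = 0"
    then have "u = - 1" by (simp add: eq_neg_iff_add_eq_0 add.commute)
    then show False
      using assms place_minus[OF assms(1), of 1] place_1[OF assms(1)] by simp
  qed
  have "0 \<le> w (1 + u)"
    using place_add[OF assms(1), of 1 u] nz assms place_1[OF assms(1)] by simp
  moreover have "min (w (1 + u)) (w u) \<le> 0"
    using place_add[OF assms(1), of "1 + u" "- u"] nz assms
    by (simp add: place_minus[OF assms(1)] place_1[OF assms(1)])
  ultimately show "w (1 + u) = 0" using assms by (simp add: min_def split: if_splits)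
qed

lemma valuation_ring_add:
  assumes "place F w" "x \<in> valuation_ring w" "y \<in> valuation_ring w"
  shows "x + y \<in> valuation_ring w"
  using assms place_add[OF assms(1), of x y]
  by (cases "x = 0 \<or> y = 0 \<or> x + y = 0") (auto simp: valuation_ring_def min_def split: if_splits)

lemma valuation_ring_mult:
  assumes "place F w" "x \<in> valuation_ring w" "y \<in> valuation_ring w"
  shows "x * y \<in> valuation_ring w"
  using assms place_mult[OF assms(1), of x y] by (cases "x = 0 \<or> y = 0") (auto simp: valuation_ring_def)

lemma valuation_ring_constant:
  assumes "place F w" "c \<in> F"
  shows "c \<in> valuation_ring w"
  using assms by (auto simp: valuation_ring_def place_def)

lemma valuation_ring_1: "place F w \<Longrightarrow> 1 \<in> valuation_ring w"
  by (simp add: valuation_ring_def place_1[of F w])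

lemma valuation_ring_minus: "place F w \<Longrightarrow> x \<in> valuation_ring w \<Longrightarrow> - x \<in> valuation_ring w"
  by (simp add: valuation_ring_def place_minus[of F w])

lemma regular_ring_add:
  "x \<in> regular_ring F i \<Longrightarrow> y \<in> regular_ring F i \<Longrightarrow> x + y \<in> regular_ring F i"
  unfolding regular_ring_def by (blast intro: valuation_ring_add)

lemma regular_ring_mult:
  "x \<in> regular_ring F i \<Longrightarrow> y \<in> regular_ring F i \<Longrightarrow> x * y \<in> regular_ring F i"
  unfolding regular_ring_def by (blast intro: valuation_ring_mult)

lemma regular_ring_constant: "c \<in> F \<Longrightarrow> c \<in> regular_ring F i"
  unfolding regular_ring_def by (blast intro: valuation_ring_constant)

lemma regular_ring_1: "1 \<in> regular_ring F i"
  unfolding regular_ring_def by (blast intro: valuation_ring_1)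

lemma regular_ring_minus: "x \<in> regular_ring F i \<Longrightarrow> - x \<in> regular_ring F i"
  unfolding regular_ring_def by (blast intro: valuation_ring_minus)

lemma regular_ring_diff:
  "x \<in> regular_ring F i \<Longrightarrow> y \<in> regular_ring F i \<Longrightarrow> x - y \<in> regular_ring F i"
  using regular_ring_add[of x F i "- y"] regular_ring_minus[of y F i] by simp

lemma regular_ring_power: "x \<in> regular_ring F i \<Longrightarrow> x ^ m \<in> regular_ring F i"
  by (induction m) (auto simp: regular_ring_1 intro: regular_ring_mult)

section \<open>Finite subfields and Fermat's little theorem\<close>

lemma
  assumes "is_subfield F"
  shows subfield_0: "0 \<in> F" and subfield_1: "1 \<in> F"
    and subfield_add: "x \<in> F \<Longrightarrow> y \<in> F \<Longrightarrow> x + y \<in> F"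
    and subfield_mult: "x \<in> F \<Longrightarrow> y \<in> F \<Longrightarrow> x * y \<in> F"
    and subfield_minus: "x \<in> F \<Longrightarrow> - x \<in> F"
    and subfield_inverse: "x \<in> F \<Longrightarrow> inverse x \<in> F"
  using assms unfolding is_subfield_def by blast+

text \<open>Translation by 1 permutes \<open>F\<close>, so the sum of its elements is unchanged when
  \<open>card F\<close> is added.\<close>

lemma of_nat_card_subfield:
  fixes F :: "'k::field set"
  assumes "is_subfield F"
  shows "(of_nat (card F) :: 'k) = 0"
proof -
  have "bij_betw (\<lambda>x. x + 1) F F"
    by (rule bij_betw_byWitness[where f' = "\<lambda>x. x + - 1"])
      (auto intro!: subfield_add[OF assms] subfield_minus[OF assms] subfield_1[OF assms]
        simp: diff_conv_add_uminus simp del: add_uminus_conv_diff)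
  then have "(\<Sum>x\<in>F. x + 1) = \<Sum>F"
    by (rule sum.reindex_bij_betw)
  then show ?thesis by (simp add: sum.distrib)
qed

text \<open>Multiplication by \<open>c\<close> permutes the nonzero elements, so their product
  absorbs the factor \<open>c ^ (card F - 1)\<close>.\<close>

lemma subfield_power_card:
  assumes F: "is_subfield F" "finite F" and c: "c \<in> F" "c \<noteq> 0"
  shows "c ^ (card F - 1) = 1"
proof -
  have "bij_betw (\<lambda>x. c * x) (F - {0}) (F - {0})"
    by (rule bij_betw_byWitness[where f' = "\<lambda>x. inverse c * x"])
      (use c in \<open>auto intro: subfield_mult[OF F(1)] subfield_inverse[OF F(1)]\<close>)
  then have "(\<Prod>x\<in>F - {0}. c * x) = \<Prod>(F - {0})"
    by (rule prod.reindex_bij_betw)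
  moreover have "(\<Prod>x\<in>F - {0}. c * x) = c ^ card (F - {0}) * \<Prod>(F - {0})"
    by (simp add: prod.distrib)
  moreover have "\<Prod>(F - {0}) \<noteq> 0" using F by simp
  moreover have "card (F - {0}) = card F - 1" using F by (simp add: subfield_0)
  ultimately show ?thesis by simp
qed

text \<open>This is where \<open>q\<close>-evenness enters: constants become invisible in the power
  sums.\<close>

lemma subfield_powi_q_even:
  assumes F: "is_subfield F" "finite F" and c: "c \<in> F" "c \<noteq> 0" and k: "q_even (card F) k"
  shows "c powi (- k) = 1"
proof -
  from k obtain j where j: "k = (int (card F) - 1) * j" by (auto simp: q_even_def)
  have "0 < card F" using F c by (auto simp: card_gt_0_iff)
  then have card: "int (card F) - 1 = int (card F - 1)" by linarith
  have "- k = int (card F - 1) * (- j)" unfolding j card by (rule minus_mult_right)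
  then have "c powi (- k) = (c powi int (card F - 1)) powi (- j)"
    by (metis power_int_mult)
  then show ?thesis using subfield_power_card[OF F c] by simp
qed

section \<open>Monic elements, coprimality to the prime and power sums\<close>

text \<open>Here \<open>sg\<close> is already the sign restricted to \<open>K\<close>, and
  triviality on one-units is expressed through \<open>ord_inf\<close>, so that the completion at
  infinity no longer appears.\<close>

locale signed_coordinate_ring =
  fixes F :: "'k::field set" and ord_inf ord_v :: "'k \<Rightarrow> int" and sg :: "'k \<Rightarrow> 'k" and v :: 'k
  assumes subfield: "is_subfield F" and finite_F: "finite F"
    and rational: "rational_place F ord_inf"
    and sg_in: "x \<noteq> 0 \<Longrightarrow> sg x \<in> F - {0}"
    and sg_mult: "x \<noteq> 0 \<Longrightarrow> y \<noteq> 0 \<Longrightarrow> sg (x * y) = sg x * sg y"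
    and sg_constant: "c \<in> F - {0} \<Longrightarrow> sg c = c"
    and sg_1_plus: "u \<noteq> 0 \<Longrightarrow> 0 < ord_inf u \<Longrightarrow> sg (1 + u) = 1"
    and v_in: "v \<in> regular_ring F ord_inf" and v_nz: "v \<noteq> 0"
    and place_of_v: "place_of_prime F ord_inf v ord_v"
begin

abbreviation A :: "'k set" where "A \<equiv> regular_ring F ord_inf"

lemma place_inf: "place F ord_inf"
  using rational by (simp add: rational_place_def)

lemma place_v: "place F ord_v"
  using place_of_v by (simp add: place_of_prime_def)

lemma F_0: "0 \<in> F" and F_inverse: "c \<in> F \<Longrightarrow> inverse c \<in> F"
  and F_minus: "c \<in> F \<Longrightarrow> - c \<in> F" and F_add: "c \<in> F \<Longrightarrow> c' \<in> F \<Longrightarrow> c + c' \<in> F"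
  using subfield unfolding is_subfield_def by blast+

lemma ord_v_v: "0 < ord_v v"
proof -
  have "v \<in> principal_ideal_of A v"
    unfolding principal_ideal_of_def using regular_ring_1[of F ord_inf] by (auto intro!: exI[of _ 1])
  then show ?thesis
    using place_of_v v_nz by (auto simp: place_of_prime_def valuation_ideal_def)
qed

text \<open>Otherwise \<open>a\<close> would be a multiple of \<open>v\<close>, and the Bezout
  relation would make 1 a multiple of \<open>v\<close> as well.\<close>

lemma coprime_v:
  assumes "a \<in> A" "coprime_in A a v"
  shows "a \<noteq> 0" "ord_v a = 0"
proof -
  obtain x y where xy: "x \<in> A" "y \<in> A" "x * a + y * v = 1"
    using assms(2) by (auto simp: coprime_in_def)
  have "a \<notin> valuation_ideal ord_v"
  proof
    assume "a \<in> valuation_ideal ord_v"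
    then have "a \<in> principal_ideal_of A v"
      using place_of_v assms(1) by (auto simp: place_of_prime_def)
    then obtain b where b: "b \<in> A" "a = v * b" by (auto simp: principal_ideal_of_def)
    have "1 = v * (x * b + y)" using xy(3) b(2) by (simp add: algebra_simps)
    moreover have "x * b + y \<in> A" using xy b by (intro regular_ring_add regular_ring_mult)
    ultimately have "1 \<in> principal_ideal_of A v" unfolding principal_ideal_of_def by blast
    then have "1 \<in> valuation_ideal ord_v"
      using place_of_v by (auto simp: place_of_prime_def)
    then show False by (simp add: valuation_ideal_def place_1[OF place_v])
  qed
  moreover have "a \<in> valuation_ring ord_v"
    using assms(1) place_of_v by (auto simp: regular_ring_def place_of_prime_def)
  ultimately show "a \<noteq> 0" "ord_v a = 0"
    by (auto simp: valuation_ideal_def valuation_ring_def)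
qed

lemma coprime_shift:
  assumes "coprime_in A a v" "t \<in> A"
  shows "coprime_in A (a + t * v) v"
proof -
  obtain x y where xy: "x \<in> A" "y \<in> A" "x * a + y * v = 1"
    using assms(1) by (auto simp: coprime_in_def)
  have "x * (a + t * v) + (y - x * t) * v = 1" using xy(3) by (simp add: algebra_simps)
  moreover have "y - x * t \<in> A" using xy assms by (intro regular_ring_diff regular_ring_mult)
  ultimately show ?thesis unfolding coprime_in_def using xy(1) by blast
qed

lemma coprime_constant_mult:
  assumes "coprime_in A a v" "c \<in> F" "c \<noteq> 0"
  shows "coprime_in A (c * a) v"
proof -
  obtain x y where xy: "x \<in> A" "y \<in> A" "x * a + y * v = 1"
    using assms(1) by (auto simp: coprime_in_def)
  have "(x * inverse c) * (c * a) = (inverse c * c) * (x * a)" by (simp only: mult_ac)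
  also have "\<dots> = x * a" using assms(3) by simp
  finally have "(x * inverse c) * (c * a) + y * v = 1" using xy(3) by (simp only:)
  moreover have "x * inverse c \<in> A"
    using xy assms F_inverse by (blast intro: regular_ring_mult regular_ring_constant)
  ultimately show ?thesis unfolding coprime_in_def using xy(2) by blast
qed

text \<open>
  That such a \<open>y\<close> does not exist is the theorem that a nonconstant function has a pole. It is not
  needed here: if there were one, then the sets of monic elements would be empty or infinite, and a
  sum over an infinite set is \<open>0\<close> in HOL.
\<close>

lemma power_sum_eq_0:
  assumes y: "y \<in> A" "y \<noteq> 0" "0 < ord_inf y"
  shows "power_sum F ord_inf sg v d k = 0"
proof -
  define S where "S = {a. a \<in> monics F ord_inf sg d \<and> coprime_in A a v}"
  have "infinite S" if a: "a \<in> S" for a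
  proof -
    \<comment> \<open>Multiplication by the one-units \<open>1 + v * y ^ i\<close> keeps degree,
      sign and coprimality to \<open>v\<close>, and different \<open>i\<close> give different
      elements.\<close>
    define g where "g = (\<lambda>i. a * (1 + v * y ^ i))"
    \<comment> \<open>From this exponent on \<open>v * y ^ i\<close> has positive order, as
      \<open>ord_inf y\<close> is at least 1.\<close>
    define i0 where "i0 = nat (- ord_inf v) + 1"
    have aA: "a \<in> A" "a \<noteq> 0" "- ord_inf a = int d" "sg a = 1" "coprime_in A a v"
      using a by (auto simp: S_def monics_def)
    have "g ` {i0..} \<subseteq> S"
    proof clarify
      fix i assume i: "i0 \<le> i"
      have nz: "v * y ^ i \<noteq> 0" using v_nz y by simp
      have "int i * 1 \<le> int i * ord_inf y" using y by (intro mult_left_mono) auto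
      moreover have "ord_inf (v * y ^ i) = ord_inf v + int i * ord_inf y"
        using v_nz y by (simp add: place_mult[OF place_inf] place_power[OF place_inf])
      ultimately have pos: "0 < ord_inf (v * y ^ i)"
        using i unfolding i0_def by linarith
      note u = place_1_plus[OF place_inf nz pos]
      have g: "g i = a + (a * y ^ i) * v" by (simp add: g_def algebra_simps)
      have "coprime_in A (g i) v"
        unfolding g using aA y by (intro coprime_shift regular_ring_mult regular_ring_power)
      moreover have "g i \<in> A"
        unfolding g using aA y v_in
        by (intro regular_ring_add regular_ring_mult regular_ring_power)
      moreover have "g i \<noteq> 0" "ord_inf (g i) = ord_inf a" "sg (g i) = 1"
        using u aA sg_1_plus[OF nz pos] by (simp_all add: g_def place_mult[OF place_inf] sg_mult)
      ultimately show "g i \<in> S" using aA by (simp add: S_def monics_def)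
    qed
    moreover have "inj_on g {i0..}"
    proof (rule inj_onI)
      fix i j assume "g i = g j"
      then have "y ^ i = y ^ j" using aA v_nz by (simp add: g_def)
      then have "int i * ord_inf y = int j * ord_inf y"
        using place_power[OF place_inf y(2)] by metis
      then show "i = j" using y by simp
    qed
    ultimately show ?thesis
      by (metis finite_imageD infinite_Ici infinite_super)
  qed
  then have "S = {} \<or> infinite S" by blast
  then show ?thesis unfolding power_sum_def S_def[symmetric] by auto
qed

definition coprimes_below :: "nat \<Rightarrow> 'k set" where
  "coprimes_below D = {a \<in> A. coprime_in A a v \<and> - ord_inf a < int D}"

text \<open>This is the case complementary to \<open>power_sum_eq_0\<close>: nonzero elements of
  \<open>A\<close> have nonnegative degree.\<close>

context
  assumes no_zero_inf: "\<And>y. y \<in> A \<Longrightarrow> y \<noteq> 0 \<Longrightarrow> ord_inf y \<le> 0"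
begin

lemma constant_approx:
  assumes "x \<noteq> 0" "0 \<le> ord_inf x"
  obtains c where "c \<in> F" "x = c \<or> 0 < ord_inf (x - c)"
proof -
  have "x \<in> valuation_ring ord_inf" using assms by (simp add: valuation_ring_def)
  then obtain c where "c \<in> F" "x - c \<in> valuation_ideal ord_inf"
    using rational by (auto simp: rational_place_def)
  then show ?thesis using that by (auto simp: valuation_ideal_def)
qed

text \<open>Rationality of the place makes leading coefficients constants in \<open>F\<close>, so
  each degree enlarges the space by at most one dimension over \<open>F\<close>.\<close>

lemma finite_bounded_degree: "finite {a \<in> A. - ord_inf a \<le> int d}"
proof (induction d)
  case 0
  have "{a \<in> A. - ord_inf a \<le> int 0} \<subseteq> F"
  proof clarify
    fix a assume a: "a \<in> A" "- ord_inf a \<le> int 0"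
    show "a \<in> F"
    proof (cases "a = 0")
      case False
      then obtain c where c: "c \<in> F" "a = c \<or> 0 < ord_inf (a - c)"
        using a constant_approx by auto
      have "a - c \<in> A" using a c by (blast intro: regular_ring_diff regular_ring_constant)
      then have "a = c" using no_zero_inf[of "a - c"] c(2) by (metis not_less right_minus_eq)
      then show ?thesis using c(1) by simp
    qed (simp add: F_0)
  qed
  then show ?case using finite_F finite_subset by blast
next
  case (Suc d)
  define V where "V = {a \<in> A. - ord_inf a \<le> int d}"
  show ?case
  proof (cases "{a \<in> A. - ord_inf a \<le> int (Suc d)} \<subseteq> V")
    case True
    then show ?thesis using Suc finite_subset unfolding V_def by blast
  next
    case False
    then obtain b where "b \<in> A" "- ord_inf b \<le> int (Suc d)" "\<not> - ord_inf b \<le> int d"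
      by (auto simp: V_def)
    then have b: "b \<in> A" "- ord_inf b = int (Suc d)" by simp_all
    \<comment> \<open>The convention \<open>ord_inf 0 = 0\<close> rules out zero, whose degree would
      be 0.\<close>
    then have bnz: "b \<noteq> 0" using place_inf by (auto simp: place_def)
    have "{a \<in> A. - ord_inf a \<le> int (Suc d)} \<subseteq> (\<lambda>(c, a). c * b + a) ` (F \<times> V)"
    proof clarify
      fix a assume a: "a \<in> A" "- ord_inf a \<le> int (Suc d)"
      obtain c where c: "c \<in> F" "a - c * b \<in> V"
      proof (cases "a = 0")
        case True
        then show ?thesis using that[of 0] F_0 a place_inf by (auto simp: V_def place_def)
      next
        case False
        have "ord_inf (a / b) = ord_inf a - ord_inf b"
          using False bnz by (simp add: divide_inverse place_mult[OF place_inf] place_inverse[OF place_inf])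
        then have "0 \<le> ord_inf (a / b)" using a b by simp
        then obtain c where c: "c \<in> F" "a / b = c \<or> 0 < ord_inf (a / b - c)"
          using constant_approx[of "a / b"] False bnz by auto
        have in_A: "a - c * b \<in> A"
          using a b c by (blast intro: regular_ring_diff regular_ring_mult regular_ring_constant)
        \<comment> \<open>The constant \<open>c\<close> is the leading coefficient of
          \<open>a\<close> relative to \<open>b\<close>; removing \<open>c * b\<close> lowers the
          degree.\<close>
        have eq: "a - c * b = (a / b - c) * b" using bnz by (simp add: field_simps)
        have "- ord_inf (a - c * b) \<le> int d"
        proof (cases "a / b = c")
          case True
          then show ?thesis using eq place_inf by (simp add: place_def)
        next
          case False
          then have "ord_inf (a - c * b) = ord_inf (a / b - c) + ord_inf b"
            unfolding eq using bnz by (intro place_mult[OF place_inf]) auto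
          then show ?thesis using False c b by auto
        qed
        then show ?thesis using that[OF c(1)] in_A by (simp add: V_def)
      qed
      then show "a \<in> (\<lambda>(c, a). c * b + a) ` (F \<times> V)"
        by (intro image_eqI[of _ _ "(c, a - c * b)"]) auto
    qed
    moreover have "finite ((\<lambda>(c, a). c * b + a) ` (F \<times> V))"
      using Suc finite_F by (simp add: V_def)
    ultimately show ?thesis by (rule finite_subset)
  qed
qed

lemma finite_coprimes_below: "finite (coprimes_below D)"
  by (rule finite_subset[OF _ finite_bounded_degree[of D]]) (auto simp: coprimes_below_def)

text \<open>Every summand is uniquely a nonzero constant times a monic element. The constants
  contribute 1 each, hence the factor \<open>card F - 1\<close>, which is -1 in
  \<open>K\<close>.\<close>

lemma sum_coprimes_below:
  assumes k: "q_even (card F) k"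
  shows "(\<Sum>a\<in>coprimes_below D. a powi (- k)) = - (\<Sum>d<D. power_sum F ord_inf sg v d k)"
proof -
  define S where "S = (\<lambda>d. {a. a \<in> monics F ord_inf sg d \<and> coprime_in A a v})"
  define M where "M = {a \<in> coprimes_below D. sg a = 1}"
  have M: "M = (\<Union>d\<in>{..<D}. S d)"
  proof (intro equalityI subsetI)
    fix a assume a: "a \<in> M"
    then have "a \<noteq> 0" using coprime_v by (auto simp: M_def coprimes_below_def)
    \<comment> \<open>The degree is nonnegative, so \<open>nat\<close> does not truncate it.\<close>
    with a no_zero_inf[of a] have "a \<in> S (nat (- ord_inf a))" "nat (- ord_inf a) < D"
      by (auto simp: M_def S_def coprimes_below_def monics_def)
    then show "a \<in> (\<Union>d\<in>{..<D}. S d)" by blast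
  qed (auto simp: M_def S_def coprimes_below_def monics_def)
  have finM: "finite M" using finite_coprimes_below by (simp add: M_def)
  then have finS: "finite (S d)" if "d < D" for d
    using that M by (metis UN_upper finite_subset lessThan_iff)
  have "(\<Sum>a\<in>M. a powi (- k)) = (\<Sum>d<D. \<Sum>a\<in>S d. a powi (- k))"
    unfolding M using finS by (intro sum.UNION_disjoint) (auto simp: S_def monics_def)
  then have sumM: "(\<Sum>a\<in>M. a powi (- k)) = (\<Sum>d<D. power_sum F ord_inf sg v d k)"
    by (simp add: S_def power_sum_def)
  have bij: "bij_betw (\<lambda>(c, a). c * a) ((F - {0}) \<times> M) (coprimes_below D)"
  proof (rule bij_betw_byWitness[where f' = "\<lambda>a. (sg a, inverse (sg a) * a)"])
    have Mnz: "a \<noteq> 0" if "a \<in> M" for a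
      using that coprime_v by (auto simp: M_def coprimes_below_def)
    have mult: "c * a \<in> coprimes_below D" if "c \<in> F" "c \<noteq> 0" "a \<in> coprimes_below D" for c a
    proof -
      have "ord_inf c = 0" using place_inf that by (simp add: place_def)
      then show ?thesis using that coprime_v[of a]
        by (auto simp: coprimes_below_def place_mult[OF place_inf] coprime_constant_mult
            intro: regular_ring_mult regular_ring_constant)
    qed
    show "\<forall>z\<in>(F - {0}) \<times> M. (\<lambda>a. (sg a, inverse (sg a) * a)) ((\<lambda>(c, a). c * a) z) = z"
      using Mnz by (auto simp: sg_mult sg_constant M_def)
    show "\<forall>a\<in>coprimes_below D. (\<lambda>(c, a). c * a) (sg a, inverse (sg a) * a) = a"
      using coprime_v(1) sg_in by (fastforce simp: coprimes_below_def)
    show "(\<lambda>(c, a). c * a) ` ((F - {0}) \<times> M) \<subseteq> coprimes_below D"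
      using mult by (auto simp: M_def)
    show "(\<lambda>a. (sg a, inverse (sg a) * a)) ` coprimes_below D \<subseteq> (F - {0}) \<times> M"
    proof (rule image_subsetI)
      fix a assume a: "a \<in> coprimes_below D"
      then have nz: "a \<noteq> 0" using coprime_v by (auto simp: coprimes_below_def)
      then have s: "sg a \<in> F" "sg a \<noteq> 0" using sg_in by auto
      then have "sg (inverse (sg a) * a) = 1"
        using nz F_inverse by (simp add: sg_mult sg_constant)
      then show "(sg a, inverse (sg a) * a) \<in> (F - {0}) \<times> M"
        using s mult[OF F_inverse[OF s(1)] _ a] by (simp add: M_def)
    qed
  qed
  have "(\<Sum>a\<in>coprimes_below D. a powi (- k)) =
      (\<Sum>(c, a)\<in>(F - {0}) \<times> M. (c * a) powi (- k))"
    using sum.reindex_bij_betw[OF bij, of "\<lambda>a. a powi (- k)"] by (simp add: case_prod_beta)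
  also have "\<dots> = (\<Sum>c\<in>F - {0}. \<Sum>a\<in>M. (c * a) powi (- k))"
    by (simp add: sum.cartesian_product)
  also have "\<dots> = (\<Sum>c\<in>F - {0}. \<Sum>a\<in>M. a powi (- k))"
    using subfield_powi_q_even[OF subfield finite_F _ _ k]
    by (intro sum.cong refl) (auto simp: power_int_mult_distrib)
  also have "\<dots> = of_nat (card (F - {0})) * (\<Sum>a\<in>M. a powi (- k))" by simp
  also have "(of_nat (card (F - {0})) :: 'k) = - 1"
  proof -
    have "card F = Suc (card (F - {0}))"
      using card_Suc_Diff1[OF finite_F F_0] by simp
    then have "1 + of_nat (card (F - {0})) = (0 :: 'k)"
      using of_nat_card_subfield[OF subfield] by (metis of_nat_Suc)
    then show ?thesis by (simp only: add_eq_0_iff)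
  qed
  finally show ?thesis using sumM by simp
qed

end

end

section \<open>Vanishing of the single zeta values\<close>

locale prime_completion = signed_coordinate_ring F ord_inf ord_v sg v + ultrametric_field N
  for F :: "'k::field set" and ord_inf ord_v :: "'k \<Rightarrow> int" and sg :: "'k \<Rightarrow> 'k" and v :: 'k
    and N :: "'l::{field,complete_space} \<Rightarrow> real" +
  fixes \<iota> :: "'k \<Rightarrow> 'l" and c :: real
  assumes \<iota>_1: "\<iota> 1 = 1" and \<iota>_add: "\<iota> (x + y) = \<iota> x + \<iota> y" and \<iota>_mult: "\<iota> (x * y) = \<iota> x * \<iota> y"
    and c_gt_1: "1 < c" and N_\<iota>: "x \<noteq> 0 \<Longrightarrow> N (\<iota> x) = c powr (- real_of_int (ord_v x))"
begin

lemma \<iota>_0: "\<iota> 0 = 0"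
  using \<iota>_add[of 0 0] by (metis add.right_neutral add_left_cancel)

lemma \<iota>_minus: "\<iota> (- x) = - \<iota> x"
  using \<iota>_add[of x "- x"] \<iota>_0 by (metis add.right_inverse minus_unique)

lemma \<iota>_sum: "\<iota> (sum f B) = (\<Sum>b\<in>B. \<iota> (f b))"
  by (induction B rule: infinite_finite_induct) (simp_all add: \<iota>_0 \<iota>_add)

lemma \<iota>_inverse: "\<iota> (inverse x) = inverse (\<iota> x)"
proof (cases "x = 0")
  case False
  then have "\<iota> x * \<iota> (inverse x) = 1" by (simp flip: \<iota>_mult add: \<iota>_1)
  then show ?thesis by (metis inverse_unique)
qed (simp add: \<iota>_0)

lemma \<iota>_power: "\<iota> (x ^ m) = \<iota> x ^ m"
  by (induction m) (simp_all add: \<iota>_1 \<iota>_mult)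

lemma \<iota>_powi: "\<iota> (x powi k) = \<iota> x powi k"
  by (simp add: power_int_def \<iota>_power \<iota>_inverse)

lemma \<iota>_of_nat: "\<iota> (of_nat m) = of_nat m"
  by (induction m) (simp_all add: \<iota>_0 \<iota>_1 \<iota>_add)

lemma N_coprime: "a \<in> A \<Longrightarrow> coprime_in A a v \<Longrightarrow> N (\<iota> a) = 1"
  using coprime_v[of a] N_\<iota>[of a] c_gt_1 by simp

lemma N_constant_le: "t \<in> F \<Longrightarrow> N (\<iota> t) \<le> 1"
  using N_\<iota>[of t] place_v c_gt_1 by (cases "t = 0") (auto simp: \<iota>_0 place_def)

lemma N_v: "N (\<iota> v) < 1"
proof -
  have "c powr (- real_of_int (ord_v v)) < c powr 0"
    using c_gt_1 ord_v_v by (intro powr_less_mono) auto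
  then show ?thesis using N_\<iota>[OF v_nz] c_gt_1 by simp
qed

text \<open>The summands are powers of \<open>v\<close>-adic units.\<close>

lemma N_power_sum_le_1: "N (\<iota> (power_sum F ord_inf sg v d k)) \<le> 1"
  unfolding power_sum_def \<iota>_sum
  by (intro N_sum_le) (auto simp: \<iota>_powi N_powi N_coprime monics_def)

text \<open>
  The set of summands is stable under translation by the multiples \<open>t * v ^ m\<close> with \<open>t \<in> F\<close>. The
  summands in one orbit are congruent modulo \<open>v ^ m\<close>, and an orbit has \<open>card F\<close> elements,
  which is \<open>0\<close> in \<open>K\<close>.
\<close>

lemma N_sum_coprimes_below_le:
  assumes fin: "finite (coprimes_below D)" and m: "0 < m" and D: "- ord_inf (v ^ m) < int D"
  shows "N (\<Sum>a\<in>coprimes_below D. \<iota> (a powi k)) \<le> N (\<iota> v) ^ m"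
proof -
  define h where "h = v ^ m"
  define orb where "orb = (\<lambda>a. (\<lambda>t. a + t * h) ` F)"
  have h_nz: "h \<noteq> 0" using v_nz by (simp add: h_def)
  \<comment> \<open>As \<open>m\<close> is positive, \<open>v\<close> divides \<open>h\<close>,
    which preserves coprimality; the degree of \<open>h\<close> is below \<open>D\<close>, which
    preserves the degree bound.\<close>
  have shift: "a + t * h \<in> coprimes_below D" if a: "a \<in> coprimes_below D" and t: "t \<in> F" for a t
  proof (cases "t = 0")
    case False
    have th: "t * h = (t * v ^ (m - 1)) * v" using m by (cases m) (simp_all add: h_def)
    have in_A: "a \<in> A" "t \<in> A"
      using a t regular_ring_constant by (auto simp: coprimes_below_def)
    have cop: "coprime_in A (a + t * h) v"
      unfolding th using a in_A v_in
      by (intro coprime_shift regular_ring_mult regular_ring_power) (auto simp: coprimes_below_def)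
    have sum_in_A: "a + t * h \<in> A"
      unfolding h_def using in_A v_in
      by (intro regular_ring_add regular_ring_mult regular_ring_power)
    have a_nz: "a \<noteq> 0" using a coprime_v by (auto simp: coprimes_below_def)
    have "ord_inf (t * h) = ord_inf h"
      using False t h_nz place_inf by (simp add: place_def)
    then have "min (ord_inf a) (ord_inf h) \<le> ord_inf (a + t * h)"
      using place_add[OF place_inf a_nz, of "t * h"] False h_nz coprime_v(1)[OF sum_in_A cop] by simp
    then have "- ord_inf (a + t * h) < int D"
      using a D by (auto simp: coprimes_below_def h_def min_def split: if_splits)
    then show ?thesis using cop sum_in_A by (simp add: coprimes_below_def)
  qed (use a in simp)
  have orb_eq: "orb (a + t * h) = orb a" if t: "t \<in> F" for a t
  proof (intro equalityI subsetI)
    fix x assume "x \<in> orb (a + t * h)"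
    then obtain r where "r \<in> F" "x = a + (t + r) * h" by (auto simp: orb_def algebra_simps)
    then show "x \<in> orb a" using F_add t by (auto simp: orb_def)
  next
    fix x assume "x \<in> orb a"
    then obtain r where r: "r \<in> F" "x = a + r * h" by (auto simp: orb_def)
    then have "x = a + t * h + (- t + r) * h" by (simp add: algebra_simps)
    moreover have "- t + r \<in> F" using F_add F_minus t r by blast
    ultimately show "x \<in> orb (a + t * h)" unfolding orb_def by blast
  qed
  have self: "a \<in> orb a" for a using F_0 by (auto simp: orb_def intro!: image_eqI[of _ _ 0])
  have fiber: "{x \<in> coprimes_below D. orb x = orb a} = orb a" if a: "a \<in> coprimes_below D" for a
  proof (intro equalityI subsetI)
    fix x assume "x \<in> orb a"
    then obtain t where "t \<in> F" "x = a + t * h" by (auto simp: orb_def)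
    then show "x \<in> {x \<in> coprimes_below D. orb x = orb a}" using shift[OF a] orb_eq by simp
  qed (use self in blast)
  have orb_sum: "N (\<Sum>x\<in>orb a. \<iota> (x powi k)) \<le> N (\<iota> h)" if a: "a \<in> coprimes_below D" for a
  proof -
    have "inj_on (\<lambda>t. a + t * h) F" using h_nz by (auto simp: inj_on_def)
    then have "(\<Sum>x\<in>orb a. \<iota> (x powi k)) = (\<Sum>t\<in>F. \<iota> ((a + t * h) powi k))"
      by (simp add: orb_def sum.reindex)
    also have "\<dots> = (\<Sum>t\<in>F. \<iota> ((a + t * h) powi k) - \<iota> (a powi k)) + of_nat (card F) * \<iota> (a powi k)"
      by (simp add: sum_subtractf)
    also have "(of_nat (card F) :: 'l) = 0"
      using \<iota>_of_nat[of "card F"] of_nat_card_subfield[OF subfield] by (simp add: \<iota>_0)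
    also have "N ((\<Sum>t\<in>F. \<iota> ((a + t * h) powi k) - \<iota> (a powi k)) + 0 * \<iota> (a powi k)) \<le> N (\<iota> h)"
    proof (simp only: mult_zero_left add_0_right, rule N_sum_le)
      fix t assume t: "t \<in> F"
      have "N (\<iota> ((a + t * h) powi k) - \<iota> (a powi k)) \<le> N (\<iota> (a + t * h) - \<iota> a)"
        unfolding \<iota>_powi using a shift[OF a t]
        by (intro N_powi_diff_le N_coprime) (auto simp: coprimes_below_def)
      also have "\<dots> = N (\<iota> t) * N (\<iota> h)" by (simp add: \<iota>_add \<iota>_mult N_mult)
      also have "\<dots> \<le> 1 * N (\<iota> h)" using N_constant_le[OF t] by (intro mult_right_mono) auto
      finally show "N (\<iota> ((a + t * h) powi k) - \<iota> (a powi k)) \<le> N (\<iota> h)" by simp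
    qed simp
    finally show ?thesis .
  qed
  \<comment> \<open>Grouping by the value of \<open>orb\<close> splits the sum into orbits, because
    the fibers of \<open>orb\<close> are the orbits themselves.\<close>
  have "N (\<Sum>a\<in>coprimes_below D. \<iota> (a powi k)) \<le> N (\<iota> h)"
    unfolding sum.image_gen[OF fin, of "\<lambda>a. \<iota> (a powi k)" orb]
    by (rule N_sum_le) (auto simp: fiber orb_sum)
  then show ?thesis by (simp add: h_def \<iota>_power N_power)
qed

text \<open>Up to sign the partial sum runs over \<open>coprimes_below D\<close>, so it is at most
  \<open>N (\<iota> v) ^ m\<close> once \<open>D\<close> exceeds the degree of \<open>v ^ m\<close>,
  and \<open>m\<close> is arbitrary. If \<open>A\<close> has a nonzero element of positive order at
  infinity, all terms are 0.\<close>

lemma sum_power_sum_tendsto_0: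
  assumes k: "q_even (card F) k"
  shows "(\<lambda>D. N (\<Sum>d<D. \<iota> (power_sum F ord_inf sg v d k))) \<longlonglongrightarrow> 0"
proof (cases "\<exists>y\<in>A. y \<noteq> 0 \<and> 0 < ord_inf y")
  case True
  then show ?thesis using power_sum_eq_0 by (auto simp: \<iota>_0)
next
  case False
  then have no_zero: "ord_inf y \<le> 0" if "y \<in> A" "y \<noteq> 0" for y using that by force
  show ?thesis
  proof (rule LIMSEQ_I)
    fix e :: real assume "0 < e"
    have "(\<lambda>m. N (\<iota> v) ^ m) \<longlonglongrightarrow> 0" using N_v by (intro LIMSEQ_realpow_zero) auto
    then have "eventually (\<lambda>m. N (\<iota> v) ^ m < e) sequentially"
      using \<open>0 < e\<close> by (rule order_tendstoD)
    then obtain m where m: "N (\<iota> v) ^ m < e" "0 < m"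
      using eventually_happens[OF eventually_conj[OF _ eventually_gt_at_top[of 0]]] by auto
    have "N (\<Sum>d<D. \<iota> (power_sum F ord_inf sg v d k)) < e"
      if D: "Suc (nat (- ord_inf (v ^ m))) \<le> D" for D
    proof -
      have "(\<Sum>d<D. \<iota> (power_sum F ord_inf sg v d k)) =
          - (\<Sum>a\<in>coprimes_below D. \<iota> (a powi (- k)))"
        using sum_coprimes_below[OF no_zero k, of D] by (simp flip: \<iota>_sum \<iota>_minus)
      then have "N (\<Sum>d<D. \<iota> (power_sum F ord_inf sg v d k)) \<le> N (\<iota> v) ^ m"
        using N_sum_coprimes_below_le[OF finite_coprimes_below[OF no_zero] m(2)] D by simp
      then show ?thesis using m by simp
    qed
    then show "\<exists>no. \<forall>D\<ge>no. norm (N (\<Sum>d<D. \<iota> (power_sum F ord_inf sg v d k)) - 0) < e"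
      by auto
  qed
qed

end

section \<open>The completion at a place as an ultrametric field\<close>

text \<open>The strong triangle inequality holds on the image of \<open>K\<close> by the valuation
  axioms and extends to the completion by density.\<close>

lemma completion_ultrametric_field:
  fixes \<iota> :: "'k::field \<Rightarrow> 'l::{field,complete_space}"
  assumes pl: "place F w" and comp: "completion_at w \<iota>"
  shows "ultrametric_field (\<lambda>x :: 'l. dist x 0)"
proof
  fix x y :: 'l
  have add: "\<iota> (a + b) = \<iota> a + \<iota> b" for a b using comp by (simp add: completion_at_def)
  have diff: "dist x y = dist (x - y) 0" for x y :: 'l
    using comp by (simp add: completion_at_def)
  show "dist x y = dist (x - y) 0" by (rule diff)
  show "dist (x * y) 0 = dist x 0 * dist y 0" using comp by (simp add: completion_at_def)
  obtain c where c: "1 < c" "\<And>a. a \<noteq> 0 \<Longrightarrow> dist (\<iota> a) 0 = c powr (- real_of_int (w a))"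
    using comp by (auto simp: completion_at_def)
  have \<iota>0: "\<iota> 0 = 0" using add[of 0 0] by (metis add.right_neutral add_left_cancel)
  have ultra: "dist (\<iota> (a + b)) 0 \<le> max (dist (\<iota> a) 0) (dist (\<iota> b) 0)" for a b
  proof (cases "a = 0 \<or> b = 0 \<or> a + b = 0")
    case False
    then have "min (w a) (w b) \<le> w (a + b)" using place_add[OF pl] by blast
    then have "w a \<le> w (a + b) \<or> w b \<le> w (a + b)" by linarith
    then show ?thesis using c False by (auto simp: le_max_iff_disj)
  qed (auto simp: \<iota>0 le_max_iff_disj)
  show "dist (x + y) 0 \<le> max (dist x 0) (dist y 0)"
  proof (rule field_le_epsilon)
    fix e :: real assume "0 < e"
    \<comment> \<open>Two thirds of \<open>e\<close> pay for replacing \<open>x + y\<close> by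
      \<open>\<iota> (a + b)\<close>, the last third for comparing the maxima.\<close>
    have "\<exists>a. dist (\<iota> a) z < e / 3" for z
    proof -
      have "z \<in> closure (range \<iota>)" using comp by (simp add: completion_at_def)
      then show ?thesis using \<open>0 < e\<close> unfolding closure_approachable
        by (metis divide_pos_pos imageE zero_less_numeral)
    qed
    then obtain a b where ab: "dist (\<iota> a) x < e / 3" "dist (\<iota> b) y < e / 3" by blast
    have "dist (x + y) (\<iota> (a + b)) \<le> dist (x + y) (\<iota> a + y) + dist (\<iota> a + y) (\<iota> (a + b))"
      by (rule dist_triangle)
    also have "dist (x + y) (\<iota> a + y) = dist (\<iota> a) x"
      using diff[of "x + y" "\<iota> a + y"] diff[of x "\<iota> a"] by (simp add: dist_commute)
    also have "dist (\<iota> a + y) (\<iota> (a + b)) = dist (\<iota> b) y"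
      using diff[of "\<iota> a + y" "\<iota> (a + b)"] diff[of y "\<iota> b"] by (simp add: add dist_commute)
    finally have 1: "dist (x + y) (\<iota> (a + b)) \<le> dist (\<iota> a) x + dist (\<iota> b) y" .
    have 2: "dist (x + y) 0 \<le> dist (x + y) (\<iota> (a + b)) + dist (\<iota> (a + b)) 0"
      by (rule dist_triangle)
    have 3: "dist (\<iota> a) 0 \<le> dist (\<iota> a) x + dist x 0" "dist (\<iota> b) 0 \<le> dist (\<iota> b) y + dist y 0"
      by (rule dist_triangle)+
    show "dist (x + y) 0 \<le> max (dist x 0) (dist y 0) + e"
      using 1 2 3 ab ultra[of a b] by linarith
  qed
qed

theorem theorem2p1:
  fixes F :: "'k::field set"
    and p e q n :: nat
    and ord_inf ord_v :: "'k \<Rightarrow> int"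
    and \<iota>_inf :: "'k \<Rightarrow> 'kinf::{field,complete_space}"
    and \<iota>_v :: "'k \<Rightarrow> 'kv::{field,complete_space}"
    and sg :: "'kinf \<Rightarrow> 'k"
    and v :: 'k
    and s :: "int list"
  assumes "prime p" and "0 < e" and "q = p ^ e"
    and "function_field F" and "card F = q"
    and "rational_place F ord_inf"
    and "completion_at ord_inf \<iota>_inf" and "sign_function F \<iota>_inf sg"
    and "prime_element_of (regular_ring F ord_inf) v" and "sg (\<iota>_inf v) = 1"
    and "place_of_prime F ord_inf v ord_v" and "completion_at ord_v \<iota>_v"
    and "odd n" and "length s = n" and "distinct s"
    and "\<forall>k\<in>set s. q_even q k"
  shows "(\<Sum>\<sigma> | \<sigma> permutes {..<n}.
            of_int (sign \<sigma>) * zeta_v F ord_inf (sg \<circ> \<iota>_inf) v \<iota>_v (permute_list \<sigma> s)) = 0"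
proof -
  obtain ci where ci: "1 < ci" "\<And>x. x \<noteq> 0 \<Longrightarrow> dist (\<iota>_inf x) 0 = ci powr (- real_of_int (ord_inf x))"
    using \<open>completion_at ord_inf \<iota>_inf\<close> by (auto simp: completion_at_def)
  have inf: "\<iota>_inf 1 = 1" "\<And>x y. \<iota>_inf (x + y) = \<iota>_inf x + \<iota>_inf y"
    "\<And>x y. \<iota>_inf (x * y) = \<iota>_inf x * \<iota>_inf y" "\<And>x y :: 'kinf. dist x y = dist (x - y) 0"
    using \<open>completion_at ord_inf \<iota>_inf\<close> by (auto simp: completion_at_def)
  have inf_nz: "\<iota>_inf x \<noteq> 0" if "x \<noteq> 0" for x
    using ci(2)[OF that] ci(1) by auto
  have sg: "\<And>x. x \<noteq> 0 \<Longrightarrow> sg x \<in> F - {0}" "\<And>x y. x \<noteq> 0 \<Longrightarrow> y \<noteq> 0 \<Longrightarrow> sg (x * y) = sg x * sg y"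
    "\<And>c. c \<in> F - {0} \<Longrightarrow> sg (\<iota>_inf c) = c" "\<And>u. dist u 1 < 1 \<Longrightarrow> sg u = 1"
    using \<open>sign_function F \<iota>_inf sg\<close> by (auto simp: sign_function_def)
  \<comment> \<open>Infinite sets have cardinality 0, so a positive \<open>card F\<close> forces
    finiteness.\<close>
  have "0 < card F" using assms(1,3,5) by (simp add: prime_gt_0_nat)
  then have "finite F" using card_gt_0_iff by blast
  interpret signed_coordinate_ring F ord_inf ord_v "sg \<circ> \<iota>_inf" v
  proof
    show "is_subfield F" using assms(4) by (simp add: function_field_def)
    show "finite F" by fact
    show "(sg \<circ> \<iota>_inf) x \<in> F - {0}" if "x \<noteq> 0" for x
      using sg(1)[OF inf_nz[OF that]] by simp
    show "(sg \<circ> \<iota>_inf) (x * y) = (sg \<circ> \<iota>_inf) x * (sg \<circ> \<iota>_inf) y" if "x \<noteq> 0" "y \<noteq> 0" for x y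
      using that by (simp add: inf sg(2) inf_nz)
    show "(sg \<circ> \<iota>_inf) c = c" if "c \<in> F - {0}" for c using sg(3)[OF that] by simp
    show "(sg \<circ> \<iota>_inf) (1 + u) = 1" if "u \<noteq> 0" "0 < ord_inf u" for u
    proof -
      \<comment> \<open>Positive order places \<open>1 + u\<close> in the open unit ball around 1,
        where the sign is 1.\<close>
      have "dist (\<iota>_inf (1 + u)) 1 = ci powr (- real_of_int (ord_inf u))"
        using inf(4)[of "\<iota>_inf (1 + u)" 1] ci(2)[OF that(1)] by (simp add: inf(1,2))
      also have "\<dots> < ci powr 0" using ci(1) that(2) by (intro powr_less_mono) auto
      finally show ?thesis using ci(1) by (simp add: sg(4))
    qed
  qed (use assms in \<open>simp_all add: prime_element_of_def\<close>)
  obtain cv where cv: "1 < cv" "\<And>x. x \<noteq> 0 \<Longrightarrow> dist (\<iota>_v x) 0 = cv powr (- real_of_int (ord_v x))"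
    using \<open>completion_at ord_v \<iota>_v\<close> by (auto simp: completion_at_def)
  interpret ultrametric_field "\<lambda>x :: 'kv. dist x 0"
    by (rule completion_ultrametric_field[OF place_v \<open>completion_at ord_v \<iota>_v\<close>])
  interpret prime_completion F ord_inf ord_v "sg \<circ> \<iota>_inf" v "\<lambda>x :: 'kv. dist x 0" \<iota>_v cv
    by unfold_locales (use \<open>completion_at ord_v \<iota>_v\<close> cv in \<open>auto simp: completion_at_def\<close>)
  show ?thesis
    using alternating_sum_zero[OF \<open>odd n\<close> \<open>length s = n\<close>,
        of "\<lambda>d k. \<iota>_v (power_sum F ord_inf (sg \<circ> \<iota>_inf) v d k)"]
      N_power_sum_le_1 sum_power_sum_tendsto_0 assms(5,14,16)
    by (simp add: zeta_v_def)
qed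

end
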